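(* For any degree $m\ge 2$, the discrete quasi-interpolants $Q_2^*$ of degree $m$ (defined in the context) are uniformly bounded independently of the partition. More specifically, for all partitions $T$ of $I$, $$\|Q_2^*\|_\infty\le\left\lfloor\tfrac12(m+4)\right\rfloor .$$
   Context: Knots and B-splines: either $I=\mathbb{R}$, $J=\mathbb{Z}$ and $T=\{t_i\}_{i\in\mathbb{Z}}$ is a strictly increasing sequence of knots partitioning $\mathbb{R}$ (so $t_i\to\pm\infty$ as $i\to\pm\infty$); or $I=[a,b]$, $J=\{0,\dots,n+m-1\}$ and the knots are $a=t_{-m}=\dots=t_0<t_1<\dots<t_{n-1}<t_n=\dots=t_{n+m}=b$. For $j\in J$, $B_j$ is the B-spline of degree $m$ with support $[t_{j-m},t_{j+1}]$, i.e. with knots $t_{j-m},\dots,t_{j+1}$, normalized so that $\sum_{j\in J}B_j=1$ on $I$. Let $\theta_j=\frac1m\sum_{r=0}^{m-1}t_{j-r}$, $\theta_j^{(2)}=\binom m2^{-1}\sum_{0\le r<s\le m-1}t_{j-r}t_{j-s}$, and $\bar\theta_j^{(2)}=\theta_j^2-\theta_j^{(2)}=\frac{1}{m^2(m-1)}\sum_{0\le r<s\le m-1}(t_{j-r}-t_{j-s})^2\ge 0$. The operator $Q_2^*$ is $$Q_2^*f=\sum_{j\in J}\mu_j^{(2)}(f)B_j,\qquad \mu_j^{(2)}(f)=f(\theta_j)-\bar\theta_j^{(2)}\,[\theta_{j-1},\theta_j,\theta_{j+1}]f,$$ where $[\theta_{j-1},\theta_j,\theta_{j+1}]f$ is the second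 order divided difference of $f$. When $I=[a,b]$ and $j=0$ or $j=n+m-1$, one has $\bar\theta_j^{(2)}=0$ and $\mu_j^{(2)}(f)$ is understood to be $f(\theta_j)$ (so that no point outside $I$ is used). $\|Q\|_\infty$ denotes the operator norm of $Q$ with respect to the sup norm on $I$, i.e. the supremum of $\|Qf\|_\infty$ over bounded continuous $f$ on $I$ with $\|f\|_\infty\le1$. $\lfloor x\rfloor$ is the integer part of $x$. *)

theory Defs
  imports "HOL-Analysis.Analysis"
begin

text \<open>
  Knot sequences are functions on the integers.  On a bounded interval only the knots
  \<open>t i\<close> with \<open>-m \<le> i \<le> n + m\<close> matter; the remaining values of \<open>t\<close> are never used.
\<close>

definition line_knots :: "(int \<Rightarrow> real) \<Rightarrow> bool" where
  "line_knots t \<longleftrightarrow> strict_mono t \<and> filterlim t at_top at_top \<and> filterlim t at_bot at_bot"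

definition interval_knots :: "nat \<Rightarrow> nat \<Rightarrow> real \<Rightarrow> real \<Rightarrow> (int \<Rightarrow> real) \<Rightarrow> bool" where
  "interval_knots m n a b t \<longleftrightarrow>
     n \<ge> 1 \<and>
     (\<forall>i\<in>{- int m..0}. t i = a) \<and>
     strict_mono_on {0..int n} t \<and>
     (\<forall>i\<in>{int n..int n + int m}. t i = b)"

definition spline_partition :: "nat \<Rightarrow> real set \<Rightarrow> int set \<Rightarrow> (int \<Rightarrow> real) \<Rightarrow> bool" where
  "spline_partition m I J t \<longleftrightarrow>
     (I = UNIV \<and> J = UNIV \<and> line_knots t) \<or>
     (\<exists>n a b. I = {a..b} \<and> J = {0..int n + int m - 1} \<and> interval_knots m n a b t)"

text \<open>
  Cox--de Boor recursion: \<open>cox_de_boor I t k i\<close> is the normalized B-spline of degree \<open>k\<close>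
  with knots \<open>t i, \<dots>, t (i + k + 1)\<close>.  Terms with a vanishing denominator are zero, as is
  customary and in agreement with \<open>x / 0 = 0\<close>.  Knot intervals are closed on the left and open
  on the right, except that the last nondegenerate one also contains the right end point of \<open>I\<close>
  (if there is one); otherwise all B-splines would vanish there.
\<close>

fun cox_de_boor :: "real set \<Rightarrow> (int \<Rightarrow> real) \<Rightarrow> nat \<Rightarrow> int \<Rightarrow> real \<Rightarrow> real" where
  "cox_de_boor I t 0 i x =
     (if t i \<le> x \<and> x < t (i + 1) \<or> t i < x \<and> x = t (i + 1) \<and> (\<forall>y\<in>I. y \<le> x) then 1 else 0)"
| "cox_de_boor I t (Suc k) i x =
     (x - t i) / (t (i + int k + 1) - t i) * cox_de_boor I t k i x +
     (t (i + int k + 2) - x) / (t (i + int k + 2) - t (i + 1)) * cox_de_boor I t k (i + 1) x"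

definition bspline :: "nat \<Rightarrow> real set \<Rightarrow> (int \<Rightarrow> real) \<Rightarrow> int \<Rightarrow> real \<Rightarrow> real" where
  "bspline m I t j = cox_de_boor I t m (j - int m)"

text \<open>
  The B-splines above are normalized as required: they sum to one on all of \<open>I\<close>, end points
  included (lemma \<open>bspline_sum_eq_1\<close>).
\<close>

lemma cox_de_boor_0_cell:
  assumes mono: "mono_on {p..q} t" and tI: "t ` {p..q} \<subseteq> I"
    and l: "l \<in> {p..<q}" "t l < t (l + 1)" "t l \<le> x"
      "x < t (l + 1) \<or> x = t (l + 1) \<and> (\<forall>y\<in>I. y \<le> x)"
    and i: "i \<in> {p..<q}"
  shows "cox_de_boor I t 0 i x = (if i = l then 1 else 0)"
proof -
  have tl: "t (l + 1) \<in> I" "t (i+1) \<in> I" using tI l i by auto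
  have 1: "t (i + 1) \<le> t l" if "i < l"
    using mono_onD[OF mono, of "i+1" l] that l i by auto
  have 2: "t (l + 1) \<le> t i" if "l < i"
    using mono_onD[OF mono, of "l+1" i] that l i by auto
  consider "i < l" | "i = l" | "l < i" by linarith
  then show ?thesis
  proof cases
    case 1
    then show ?thesis using \<open>i < l \<Longrightarrow> _\<close> l tl by force
  next
    case 2
    then show ?thesis using l by auto
  next
    case 3
    then show ?thesis using \<open>l < i \<Longrightarrow> _\<close> l tl by force
  qed
qed

lemma cox_de_boor_cell_eq_0:
  assumes mono: "mono_on {p..q} t" and tI: "t ` {p..q} \<subseteq> I"
    and l: "l \<in> {p..<q}" "t l < t (l + 1)" "t l \<le> x"
      "x < t (l + 1) \<or> x = t (l + 1) \<and> (\<forall>y\<in>I. y \<le> x)"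
    and i: "i \<in> {p..<q - int k}" "i \<notin> {l - int k..l}"
  shows "cox_de_boor I t k i x = 0"
  using i
proof (induction k arbitrary: i)
  case 0
  then show ?case using cox_de_boor_0_cell[OF mono tI l, of i] by auto
next
  case (Suc k)
  have "cox_de_boor I t k i x = 0" "cox_de_boor I t k (i + 1) x = 0"
    using Suc.prems by (auto intro!: Suc.IH)
  then show ?case by simp
qed

lemma cox_de_boor_cell_sum:
  assumes mono: "mono_on {p..q} t" and tI: "t ` {p..q} \<subseteq> I"
    and l: "l \<in> {p..<q}" "t l < t (l + 1)" "t l \<le> x"
      "x < t (l + 1) \<or> x = t (l + 1) \<and> (\<forall>y\<in>I. y \<le> x)"
    and k: "p \<le> l - int k" "l + int k + 1 \<le> q"
  shows "(\<Sum>i\<in>{l - int k..l}. cox_de_boor I t k i x) = 1"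
  using k
proof (induction k)
  case 0
  then show ?case using cox_de_boor_0_cell[OF mono tI l, of l] l by auto
next
  case (Suc k)
  let ?N = "\<lambda>i. cox_de_boor I t k i x"
  let ?w = "\<lambda>i. (x - t i) / (t (i + int k + 1) - t i)"
  let ?v = "\<lambda>i. (t (i + int k + 1) - x) / (t (i + int k + 1) - t i)"
  have z: "?N (l - int k - 1) = 0" "?N (l + 1) = 0"
    using Suc.prems l by (auto intro!: cox_de_boor_cell_eq_0[OF mono tI l])
  have s1: "{l - int (Suc k)..l} = insert (l - int k - 1) {l - int k..l}" by auto
  have s2: "(\<lambda>i. i + 1) ` {l - int (Suc k)..l} = insert (l + 1) {l - int k..l}"
    by (auto simp: image_iff)
  have "(\<Sum>i\<in>{l - int (Suc k)..l}. cox_de_boor I t (Suc k) i x)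
      = (\<Sum>i\<in>{l - int (Suc k)..l}. ?w i * ?N i) + (\<Sum>i\<in>{l - int (Suc k)..l}. ?v (i + 1) * ?N (i + 1))"
    by (simp add: sum.distrib algebra_simps)
  also have "(\<Sum>i\<in>{l - int (Suc k)..l}. ?w i * ?N i) = (\<Sum>i\<in>{l - int k..l}. ?w i * ?N i)"
    unfolding s1 using z by simp
  also have "(\<Sum>i\<in>{l - int (Suc k)..l}. ?v (i + 1) * ?N (i + 1))
      = (\<Sum>i\<in>(\<lambda>i. i + 1) ` {l - int (Suc k)..l}. ?v i * ?N i)"
    by (subst sum.reindex) (auto simp: inj_on_def)
  also have "\<dots> = (\<Sum>i\<in>{l - int k..l}. ?v i * ?N i)"
    unfolding s2 using z by simp
  also have "(\<Sum>i\<in>{l - int k..l}. ?w i * ?N i) + (\<Sum>i\<in>{l - int k..l}. ?v i * ?N i)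
      = (\<Sum>i\<in>{l - int k..l}. ?N i)"
    unfolding sum.distrib[symmetric]
  proof (rule sum.cong[OF refl])
    fix i assume i: "i \<in> {l - int k..l}"
    have "t i \<le> t l" "t (l + 1) \<le> t (i + int k + 1)"
      using i Suc.prems l by (auto intro!: mono_onD[OF mono])
    then have "t i < t (i + int k + 1)" using l by linarith
    then have "?w i + ?v i = 1" by (simp add: add_divide_distrib[symmetric])
    then show "?w i * ?N i + ?v i * ?N i = ?N i" by (metis distrib_right mult_1)
  qed
  also have "\<dots> = 1" using Suc by simp
  finally show ?case .
qed

lemma bspline_sum_cell:
  assumes mono: "mono_on {p..q} t" and tI: "t ` {p..q} \<subseteq> I"
    and l: "t l < t (l + 1)" "t l \<le> x"
      "x < t (l + 1) \<or> x = t (l + 1) \<and> (\<forall>y\<in>I. y \<le> x)"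
    and k: "p \<le> l - int m" "l + int m + 1 \<le> q"
    and J: "{l..l + int m} \<subseteq> J"
    and J0: "\<And>j. j \<in> J \<Longrightarrow> j \<notin> {l..l + int m} \<Longrightarrow> bspline m I t j x = 0"
  shows "(\<Sum>\<^sub>\<infinity>j\<in>J. bspline m I t j x) = 1"
proof -
  have "(\<Sum>\<^sub>\<infinity>j\<in>J. bspline m I t j x) = (\<Sum>\<^sub>\<infinity>j\<in>{l..l + int m}. bspline m I t j x)"
    by (rule infsum_cong_neutral) (use J J0 in auto)
  also have "\<dots> = (\<Sum>j\<in>{l..l + int m}. bspline m I t j x)" by simp
  also have "\<dots> = (\<Sum>i\<in>{l - int m..l}. cox_de_boor I t m i x)"
    unfolding bspline_def
    by (rule sum.reindex_bij_witness[of _ "\<lambda>i. i + int m" "\<lambda>i. i - int m"]) auto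
  also have "\<dots> = 1"
    by (rule cox_de_boor_cell_sum[OF mono tI _ l]) (use k in auto)
  finally show ?thesis .
qed

lemma bspline_sum_eq_1:
  assumes "spline_partition m I J t" "x \<in> I"
  shows "(\<Sum>\<^sub>\<infinity>j\<in>J. bspline m I t j x) = 1"
  using assms(1) unfolding spline_partition_def
proof (elim disjE exE conjE)
  assume IJ: "I = UNIV" "J = UNIV" and "line_knots t"
  then have sm: "strict_mono t" and top: "filterlim t at_top at_top" and bot: "filterlim t at_bot at_bot"
    by (auto simp: line_knots_def)
  obtain u where u: "x < t u"
    using eventually_happens[OF filterlim_at_top_dense[THEN iffD1, OF top, rule_format, of x]] by auto
  obtain d where d: "t d \<le> x"
    using eventually_happens[OF filterlim_at_bot[THEN iffD1, OF bot, rule_format, of x]] by auto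
  let ?S = "{i\<in>{d..u}. t i \<le> x}"
  define l where "l = Max ?S"
  have du: "d < u" using u d sm by (meson le_less_trans strict_mono_less)
  have fin: "finite ?S" by (rule finite_subset[of _ "{d..u}"]) auto
  have "d \<in> ?S" using d du by auto
  then have "l \<in> ?S" unfolding l_def using Max_in[OF fin] by blast
  moreover have "l + 1 \<notin> ?S"
  proof
    assume "l + 1 \<in> ?S"
    then have "l + 1 \<le> l" using Max_ge[OF fin, of "l + 1"] unfolding l_def by blast
    then show False by simp
  qed
  moreover have "l \<noteq> u" using \<open>l \<in> ?S\<close> u by auto
  ultimately have l: "t l \<le> x" "x < t (l + 1)" by auto
  have mono: "mono_on A t" for A using sm by (simp add: mono_on_def strict_mono_less_eq)
  have lt: "t l < t (l + 1)" using l by linarith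
  show ?thesis
  proof (rule bspline_sum_cell[OF mono _ lt l(1)])
    fix j assume "j \<notin> {l..l + int m}"
    then show "bspline m I t j x = 0" unfolding bspline_def
      by (intro cox_de_boor_cell_eq_0[of "min l (j - int m)" "max l j + int m + 1", OF mono _ _ lt l(1)])
        (use l IJ in auto)
  qed (use IJ l in auto)
next
  fix n a b assume IJ: "I = {a..b}" "J = {0..int n + int m - 1}" and K: "interval_knots m n a b t"
  then have n: "n \<ge> 1" and ta: "\<And>i. i \<in> {- int m..0} \<Longrightarrow> t i = a"
    and sm: "strict_mono_on {0..int n} t" and tb: "\<And>i. i \<in> {int n..int n + int m} \<Longrightarrow> t i = b"
    by (auto simp: interval_knots_def)
  have m0: "mono_on {0..int n} t" using sm by (rule strict_mono_on_imp_mono_on)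
  have tm: "t (max 0 (min i (int n))) = t i" if "i \<in> {- int m..int n + int m}" for i
    using that ta[of i] ta[of 0] tb[of i] tb[of "int n"] by (auto simp: max_def min_def)
  have mono: "mono_on {- int m..int n + int m} t"
  proof (rule mono_onI)
    fix i j assume "i \<in> {- int m..int n + int m}" "j \<in> {- int m..int n + int m}" "i \<le> j"
    then show "t i \<le> t j"
      using mono_onD[OF m0, of "max 0 (min i (int n))" "max 0 (min j (int n))"] tm[of i] tm[of j] by auto
  qed
  have ab: "t 0 = a" "t (int n) = b" using ta[of 0] tb[of "int n"] by auto
  have tI: "t ` {- int m..int n + int m} \<subseteq> I"
  proof
    fix y assume "y \<in> t ` {- int m..int n + int m}"
    then obtain i where i: "i \<in> {- int m..int n + int m}" "y = t i" by auto
    show "y \<in> I" using i ta[of "- int m"] tb[of "int n + int m"]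
        mono_onD[OF mono, of "- int m" i] mono_onD[OF mono, of i "int n + int m"] by (auto simp: IJ)
  qed
  let ?S = "{i\<in>{0..int n - 1}. t i \<le> x}"
  define l where "l = Max ?S"
  have xab: "a \<le> x" "x \<le> b" using assms(2) IJ by auto
  have fin: "finite ?S" by (rule finite_subset[of _ "{0..int n - 1}"]) auto
  have "0 \<in> ?S" using xab ab n by auto
  then have lS: "l \<in> ?S" unfolding l_def using Max_in[OF fin] by blast
  have "l + 1 \<notin> ?S"
  proof
    assume "l + 1 \<in> ?S"
    then have "l + 1 \<le> l" using Max_ge[OF fin, of "l + 1"] unfolding l_def by blast
    then show False by simp
  qed
  then have l: "t l \<le> x" "x < t (l + 1) \<or> x = t (l + 1) \<and> (\<forall>y\<in>I. y \<le> x)"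
    using lS ab xab IJ by (cases "l + 1 = int n"; force)+
  have lt: "t l < t (l + 1)" using sm lS by (auto simp: strict_mono_on_def)
  show ?thesis
  proof (rule bspline_sum_cell[OF mono tI lt l])
    fix j assume "j \<in> J" "j \<notin> {l..l + int m}"
    then show "bspline m I t j x = 0" unfolding bspline_def
      by (intro cox_de_boor_cell_eq_0[OF mono tI _ lt l]) (use IJ lS in auto)
  qed (use IJ lS in auto)
qed

definition theta :: "nat \<Rightarrow> (int \<Rightarrow> real) \<Rightarrow> int \<Rightarrow> real" where
  "theta m t j = (\<Sum>r<m. t (j - int r)) / real m"

definition theta2 :: "nat \<Rightarrow> (int \<Rightarrow> real) \<Rightarrow> int \<Rightarrow> real" where
  "theta2 m t j = (\<Sum>s<m. \<Sum>r<s. t (j - int r) * t (j - int s)) / real (m choose 2)"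

definition theta2_bar :: "nat \<Rightarrow> (int \<Rightarrow> real) \<Rightarrow> int \<Rightarrow> real" where
  "theta2_bar m t j = (theta m t j)\<^sup>2 - theta2 m t j"

definition divided_difference2 :: "real \<Rightarrow> real \<Rightarrow> real \<Rightarrow> (real \<Rightarrow> real) \<Rightarrow> real" where
  "divided_difference2 x y z f =
     ((f z - f y) / (z - y) - (f y - f x) / (y - x)) / (z - x)"

text \<open>
  If \<open>J\<close> is finite, exactly its first and last index lack a neighbour in \<open>J\<close>; there
  \<open>theta2_bar\<close> vanishes and the functional is point evaluation.
\<close>

definition mu2 :: "nat \<Rightarrow> int set \<Rightarrow> (int \<Rightarrow> real) \<Rightarrow> int \<Rightarrow> (real \<Rightarrow> real) \<Rightarrow> real" where
  "mu2 m J t j f =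
     (if j - 1 \<in> J \<and> j + 1 \<in> J
      then f (theta m t j) -
           theta2_bar m t j *
           divided_difference2 (theta m t (j - 1)) (theta m t j) (theta m t (j + 1)) f
      else f (theta m t j))"

text \<open>For every \<open>x\<close> only finitely many terms of the following sum are nonzero.\<close>

definition Q2_star ::
  "nat \<Rightarrow> real set \<Rightarrow> int set \<Rightarrow> (int \<Rightarrow> real) \<Rightarrow> (real \<Rightarrow> real) \<Rightarrow> real \<Rightarrow> real" where
  "Q2_star m I J t f x = (\<Sum>\<^sub>\<infinity>j\<in>J. mu2 m J t j f * bspline m I t j x)"

text \<open>
  Norms take values in the extended reals, so that an unbounded function or operator has norm
  \<open>\<infinity>\<close>.  Functions on \<open>I\<close> are total functions of which only the values on \<open>I\<close> are used.
\<close>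

definition sup_norm_on :: "real set \<Rightarrow> (real \<Rightarrow> real) \<Rightarrow> ereal" where
  "sup_norm_on I f = (SUP x\<in>I. ereal \<bar>f x\<bar>)"

definition operator_sup_norm :: "real set \<Rightarrow> ((real \<Rightarrow> real) \<Rightarrow> real \<Rightarrow> real) \<Rightarrow> ereal" where
  "operator_sup_norm I Q =
     (SUP f\<in>{f. continuous_on I f \<and> bounded (f ` I) \<and> sup_norm_on I f \<le> 1}.
        sup_norm_on I (Q f))"

end

theory Submission
  imports Defs
begin

text \<open>
  The B-splines are nonnegative and sum to one, so \<open>Q2_star\<close> forms convex combinations of the
  numbers \<open>mu2 m J t j f\<close>, and its norm is at most the largest norm of these functionals.
  Write \<open>p = t (j + 1) - t (j - m + 1)\<close> and \<open>q = t j - t (j - m)\<close>.  Neighbouring \<open>\<theta>\<close>'s have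
  the distances \<open>p / m\<close> and \<open>q / m\<close>, and the weights of \<open>[x, y, z]\<close> have absolute sum
  \<open>2 / ((y - x) (z - y))\<close>.  The functional is therefore bounded by
  \<open>1 + 2 m\<^sup>2 theta2_bar m t j / (p q)\<close>, which by \<open>theta2_bar_eq_sum\<close> is
  \<open>1 + 2 S / ((m - 1) p q)\<close>, where \<open>S\<close> is the sum of the squared pairwise distances of the \<open>m\<close> knots
  \<open>t (j - m + 1), \<dots>, t j\<close>.

  These knots lie in an interval whose length \<open>L\<close> is at most \<open>p\<close> and \<open>q\<close>, so what
  matters is how large \<open>S\<close> can be for \<open>m\<close> points in an interval of length \<open>L\<close>.
  It is at most \<open>\<lfloor>m / 2\<rfloor> \<lceil>m / 2\<rceil> L\<^sup>2\<close> (\<open>sum_pair_square_dist_le\<close>), the value for points divided as evenly as possible between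
  the two ends.  The integer parts are essential: for odd \<open>m\<close> the estimate \<open>m\<^sup>2 L\<^sup>2 / 4\<close> by the
  variance would exceed the claimed bound.  With them, elementary arithmetic
  (\<open>balanced_pairs_le\<close>) bounds the norm by \<open>\<lfloor>m / 2\<rfloor> + 2 = \<lfloor>(m + 4) / 2\<rfloor>\<close>.
\<close>

section \<open>Pairwise distances of points in an interval\<close>

lemma sum_pair_diff:
  fixes x :: "nat \<Rightarrow> real"
  shows "(\<Sum>s<m. \<Sum>r<s. x r - x s) = (\<Sum>i<m. (real m - 1 - 2 * real i) * x i)"
proof (induction m)
  case (Suc m)
  have "(\<Sum>i<m. (real (Suc m) - 1 - 2 * real i) * x i)
      = (\<Sum>i<m. (real m - 1 - 2 * real i) * x i) + (\<Sum>i<m. x i)"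
    by (simp add: sum.distrib[symmetric] algebra_simps)
  then show ?case
    using Suc by (simp add: sum_subtractf algebra_simps)
qed simp

lemma sum_pos_part_coeff:
  "(\<Sum>i<m. max 0 (real m - 1 - 2 * real i)) = real ((m div 2) * ((m + 1) div 2))"
proof (induction m rule: less_induct)
  case (less m)
  consider "m = 0" | "m = 1" | k where "m = Suc (Suc k)"
    by (metis One_nat_def not0_implies_Suc)
  then show ?case
  proof cases
    case 3
    have "(\<Sum>i<m. max 0 (real m - 1 - 2 * real i))
        = (real k + 1) + (\<Sum>i<Suc k. max 0 (real k - 1 - 2 * real i))"
      unfolding 3 by (subst sum.lessThan_Suc_shift) (simp add: algebra_simps)
    also have "(\<Sum>i<Suc k. max 0 (real k - 1 - 2 * real i))
        = (\<Sum>i<k. max 0 (real k - 1 - 2 * real i))"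
      by simp
    also have "\<dots> = real ((k div 2) * ((k + 1) div 2))"
      using less 3 by simp
    also have "real k + 1 + \<dots> = real (k div 2 + (k + 1) div 2 + 1 + (k div 2) * ((k + 1) div 2))"
    proof -
      have "k div 2 + (k + 1) div 2 = k" by presburger
      then show ?thesis by simp
    qed
    finally show ?thesis using 3 by (simp add: algebra_simps)
  qed simp_all
qed

text \<open>
  On an ordered family of diameter \<open>L\<close> a squared distance is at most \<open>L\<close> times the distance,
  and the sum of the distances is linear in the points, with coefficients \<open>m - 1 - 2 i\<close> of total
  zero.  It is thus largest when the points with positive coefficients are at the top of the
  interval and the others at the bottom.
\<close>

lemma sum_pair_square_dist_le:
  fixes x :: "nat \<Rightarrow> real"
  assumes anti: "\<And>r s. r \<le> s \<Longrightarrow> s < m \<Longrightarrow> x s \<le> x r"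
    and bounds: "\<And>i. i < m \<Longrightarrow> l \<le> x i" "\<And>i. i < m \<Longrightarrow> x i \<le> u"
  shows "(\<Sum>s<m. \<Sum>r<s. (x r - x s)\<^sup>2) \<le> real ((m div 2) * ((m + 1) div 2)) * (u - l)\<^sup>2"
proof (cases "m = 0")
  case False
  then have L: "0 \<le> u - l" using bounds[of 0] by simp
  have "(\<Sum>s<m. \<Sum>r<s. (x r - x s)\<^sup>2) \<le> (\<Sum>s<m. \<Sum>r<s. (u - l) * (x r - x s))"
  proof (intro sum_mono)
    fix s r assume "s \<in> {..<m}" "r \<in> {..<s}"
    then show "(x r - x s)\<^sup>2 \<le> (u - l) * (x r - x s)"
      unfolding power2_eq_square
      using anti[of r s] bounds(1)[of s] bounds(2)[of r] by (intro mult_right_mono) auto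
  qed
  also have "\<dots> = (u - l) * (\<Sum>s<m. \<Sum>r<s. (x r - l) - (x s - l))"
    by (simp add: sum_distrib_left)
  also have "(\<Sum>s<m. \<Sum>r<s. (x r - l) - (x s - l))
      = (\<Sum>i<m. (real m - 1 - 2 * real i) * (x i - l))"
    by (rule sum_pair_diff)
  also have "\<dots> \<le> (\<Sum>i<m. max 0 (real m - 1 - 2 * real i) * (u - l))"
  proof (intro sum_mono)
    fix i assume "i \<in> {..<m}"
    then have i: "0 \<le> x i - l" "x i - l \<le> u - l" using bounds by auto
    have "(real m - 1 - 2 * real i) * (x i - l) \<le> max 0 (real m - 1 - 2 * real i) * (x i - l)"
      using i by (intro mult_right_mono) auto
    also have "\<dots> \<le> max 0 (real m - 1 - 2 * real i) * (u - l)"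
      using i by (intro mult_left_mono) auto
    finally show "(real m - 1 - 2 * real i) * (x i - l)
        \<le> max 0 (real m - 1 - 2 * real i) * (u - l)" .
  qed
  also have "\<dots> = real ((m div 2) * ((m + 1) div 2)) * (u - l)"
    by (simp add: sum_distrib_right[symmetric] sum_pos_part_coeff)
  finally show ?thesis
    using L by (simp add: power2_eq_square mult_left_mono mult.left_commute)
qed simp

lemma balanced_pairs_le:
  fixes m :: nat
  shows "2 * ((m div 2) * ((m + 1) div 2)) \<le> (m - 1) * (m div 2 + 1)"
proof (cases "even m")
  case True
  then obtain k where k: "m = 2 * k" by auto
  then show ?thesis by (cases k) auto
next
  case False
  then obtain k where "m = 2 * k + 1" using oddE by blast
  then show ?thesis by simp
qed

section \<open>The correction coefficient\<close>

lemma square_sum_pairs: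
  fixes x :: "nat \<Rightarrow> real"
  shows "(\<Sum>i<m. x i)\<^sup>2 = (\<Sum>i<m. (x i)\<^sup>2) + 2 * (\<Sum>s<m. \<Sum>r<s. x r * x s)"
  by (induction m) (simp_all add: power2_sum sum_distrib_left algebra_simps)

lemma sum_pair_square_dist_eq:
  fixes x :: "nat \<Rightarrow> real"
  shows "(\<Sum>s<m. \<Sum>r<s. (x r - x s)\<^sup>2)
    = (real m - 1) * (\<Sum>i<m. (x i)\<^sup>2) - 2 * (\<Sum>s<m. \<Sum>r<s. x r * x s)"
proof (induction m)
  case (Suc m)
  have "(\<Sum>r<m. (x r - x m)\<^sup>2)
      = (\<Sum>r<m. (x r)\<^sup>2) + real m * (x m)\<^sup>2 - 2 * (\<Sum>r<m. x r * x m)"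
    by (simp add: power2_diff sum.distrib sum_subtractf sum_distrib_left mult.assoc)
  then show ?case
    using Suc by (simp add: algebra_simps)
qed simp

lemma theta2_bar_eq_sum:
  assumes "m \<ge> 2"
  shows "theta2_bar m t j
    = (\<Sum>s<m. \<Sum>r<s. (t (j - int r) - t (j - int s))\<^sup>2) / ((real m)\<^sup>2 * (real m - 1))"
proof -
  let ?S2 = "\<Sum>i<m. (t (j - int i))\<^sup>2"
  let ?P = "\<Sum>s<m. \<Sum>r<s. t (j - int r) * t (j - int s)"
  have ch: "real (m choose 2) = real m * (real m - 1) / 2"
    by (induction m) (auto simp: numeral_2_eq_2 field_simps)
  have "theta2_bar m t j = (?S2 + 2 * ?P) / (real m)\<^sup>2 - ?P / (real m * (real m - 1) / 2)"
    unfolding theta2_bar_def theta_def theta2_def ch power_divide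
    by (simp add: square_sum_pairs)
  also have "\<dots> = ((real m - 1) * ?S2 - 2 * ?P) / ((real m)\<^sup>2 * (real m - 1))"
    using assms by (simp add: field_simps power2_eq_square)
  finally show ?thesis by (simp add: sum_pair_square_dist_eq)
qed

lemma theta_diff:
  assumes "m \<ge> 1"
  shows "theta m t (j + 1) - theta m t j = (t (j + 1) - t (j - int m + 1)) / real m"
proof -
  obtain k where k: "m = Suc k" using assms by (cases m) auto
  have "(\<Sum>r<m. t (j + 1 - int r)) = t (j + 1) + (\<Sum>r<k. t (j - int r))"
    unfolding k by (subst sum.lessThan_Suc_shift) simp
  moreover have "(\<Sum>r<m. t (j - int r)) = (\<Sum>r<k. t (j - int r)) + t (j - int m + 1)"
    unfolding k by simp
  ultimately show ?thesis
    unfolding theta_def by (simp add: diff_divide_distrib[symmetric])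
qed

text \<open>
  The two adjacent gaps between the \<open>\<theta>\<close>'s each dominate, up to the factor \<open>1 / m\<close>, the length of
  the stretch \<open>t (j - m + 1), \<dots>, t j\<close> over which \<open>theta2_bar\<close> measures the spread of the knots.
\<close>

lemma theta2_bar_bounds:
  assumes m: "m \<ge> 2" and mono: "mono_on {j - int m..j + 1} t"
  shows "0 \<le> theta2_bar m t j"
    and "2 * theta2_bar m t j \<le> real (m div 2 + 1) *
      ((theta m t j - theta m t (j - 1)) * (theta m t (j + 1) - theta m t j))"
proof -
  let ?S = "\<Sum>s<m. \<Sum>r<s. (t (j - int r) - t (j - int s))\<^sup>2"
  let ?L = "t j - t (j - int m + 1)"
  let ?p = "t (j + 1) - t (j - int m + 1)"
  let ?q = "t j - t (j - int m)"
  have m1: "real m - 1 > 0" "real m - 1 = real (m - 1)" using m by (auto simp: of_nat_diff)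
  have S0: "0 \<le> ?S" by (intro sum_nonneg) auto
  show "0 \<le> theta2_bar m t j"
    unfolding theta2_bar_eq_sum[OF m] using S0 m1(1) by simp
  have "?S \<le> real ((m div 2) * ((m + 1) div 2)) * ?L\<^sup>2"
    by (rule sum_pair_square_dist_le) (auto intro!: mono_onD[OF mono])
  moreover have "real (2 * ((m div 2) * ((m + 1) div 2))) * ?L\<^sup>2
      \<le> real ((m - 1) * (m div 2 + 1)) * ?L\<^sup>2"
    by (intro mult_right_mono of_nat_mono balanced_pairs_le) simp
  moreover have "?L\<^sup>2 \<le> ?p * ?q"
    unfolding power2_eq_square
    using m by (intro mult_mono) (auto intro!: mono_onD[OF mono])
  then have "real ((m - 1) * (m div 2 + 1)) * ?L\<^sup>2 \<le> real ((m - 1) * (m div 2 + 1)) * (?p * ?q)"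
    by (intro mult_left_mono) auto
  ultimately have S: "2 * ?S \<le> (real m - 1) * (real (m div 2 + 1) * (?p * ?q))"
    unfolding m1(2) by (simp only: of_nat_mult of_nat_numeral mult.assoc)
  have "2 * theta2_bar m t j = 2 * ?S / ((real m)\<^sup>2 * (real m - 1))"
    by (simp add: theta2_bar_eq_sum[OF m])
  also have "\<dots> \<le> (real m - 1) * (real (m div 2 + 1) * (?p * ?q)) / ((real m)\<^sup>2 * (real m - 1))"
    using S m1(1) by (intro divide_right_mono) auto
  also have "\<dots> = real (m div 2 + 1) * ((?q / real m) * (?p / real m))"
    using m1(1) by (simp add: power2_eq_square)
  also have "?q / real m = theta m t j - theta m t (j - 1)"
    using theta_diff[of m t "j - 1"] m by simp
  also have "?p / real m = theta m t (j + 1) - theta m t j"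
    using theta_diff[of m t j] m by simp
  finally show "2 * theta2_bar m t j \<le> real (m div 2 + 1) *
      ((theta m t j - theta m t (j - 1)) * (theta m t (j + 1) - theta m t j))" .
qed

section \<open>The coefficient functionals\<close>

lemma divided_difference2_abs_le:
  assumes "x < y" "y < z" and f: "\<bar>f x\<bar> \<le> 1" "\<bar>f y\<bar> \<le> 1" "\<bar>f z\<bar> \<le> 1"
  shows "\<bar>divided_difference2 x y z f\<bar> \<le> 2 / ((y - x) * (z - y))"
proof -
  have "\<bar>(f z - f y) / (z - y)\<bar> \<le> 2 / (z - y)" "\<bar>(f y - f x) / (y - x)\<bar> \<le> 2 / (y - x)"
    unfolding abs_divide using assms by (auto intro!: divide_right_mono)
  then have "\<bar>(f z - f y) / (z - y) - (f y - f x) / (y - x)\<bar> \<le> 2 / (z - y) + 2 / (y - x)"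
    by linarith
  then have "\<bar>divided_difference2 x y z f\<bar> \<le> (2 / (z - y) + 2 / (y - x)) / (z - x)"
    unfolding divided_difference2_def abs_divide
    using assms by (auto intro!: divide_right_mono)
  also have "2 / (z - y) + 2 / (y - x) = 2 * (z - x) / ((y - x) * (z - y))"
    using assms by (simp add: field_simps)
  also have "\<dots> / (z - x) = 2 / ((y - x) * (z - y))"
  proof -
    have "2 * d / c / d = 2 / c" if "d \<noteq> 0" for c d :: real
      using that by simp
    note this[of "z - x" "(y - x) * (z - y)"]
    then show ?thesis using assms(1,2) by linarith
  qed
  finally show ?thesis .
qed

text \<open>
  The strict inequalities make the three evaluation points distinct.  The vanishing factor
  \<open>(y - x) (z - y)\<close> by which the divided difference blows up when knots cluster is the very
  factor that bounds the coefficient in front of it, so no mesh ratio enters.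
\<close>

lemma mu2_abs_le:
  assumes m: "m \<ge> 2" and mono: "mono_on {j - int m..j + 1} t"
    and strict: "j - 1 \<in> J \<Longrightarrow> j + 1 \<in> J \<Longrightarrow> t (j - int m) < t j \<and> t (j - int m + 1) < t (j + 1)"
    and f: "\<bar>f (theta m t j)\<bar> \<le> 1"
      "j - 1 \<in> J \<Longrightarrow> \<bar>f (theta m t (j - 1))\<bar> \<le> 1"
      "j + 1 \<in> J \<Longrightarrow> \<bar>f (theta m t (j + 1))\<bar> \<le> 1"
  shows "\<bar>mu2 m J t j f\<bar> \<le> real (m div 2 + 2)"
proof (cases "j - 1 \<in> J \<and> j + 1 \<in> J")
  case True
  let ?x = "theta m t (j - 1)" and ?y = "theta m t j" and ?z = "theta m t (j + 1)"
  have "0 < ?y - ?x"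
    using theta_diff[of m t "j - 1"] strict True m by simp
  moreover have "0 < ?z - ?y"
    using theta_diff[of m t j] strict True m by simp
  ultimately have lt: "?x < ?y" "?y < ?z" by simp_all
  have "\<bar>theta2_bar m t j * divided_difference2 ?x ?y ?z f\<bar>
      \<le> theta2_bar m t j * (2 / ((?y - ?x) * (?z - ?y)))"
    unfolding abs_mult abs_of_nonneg[OF theta2_bar_bounds(1)[OF m mono]]
    using True lt f
    by (intro mult_left_mono divided_difference2_abs_le theta2_bar_bounds(1)[OF m mono]) auto
  also have "\<dots> = 2 * theta2_bar m t j / ((?y - ?x) * (?z - ?y))" by simp
  also have "\<dots> \<le> real (m div 2 + 1)"
    using theta2_bar_bounds(2)[OF m mono] lt by (subst pos_divide_le_eq) auto
  finally show ?thesis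
    using True f(1) unfolding mu2_def by simp
next
  case False
  then show ?thesis using f(1) unfolding mu2_def by auto
qed

section \<open>Nonnegativity of the B-splines\<close>

text \<open>
  Both weights in the recursion are nonnegative on the support of the B-spline they multiply,
  but not elsewhere; so the sign and the support have to be treated together.
\<close>

lemma cox_de_boor_nonneg_support:
  assumes "mono_on {i..i + int k + 1} t"
  shows "0 \<le> cox_de_boor I t k i x \<and>
    (cox_de_boor I t k i x \<noteq> 0 \<longrightarrow> t i \<le> x \<and> x \<le> t (i + int k + 1))"
  using assms
proof (induction k arbitrary: i)
  case 0
  then show ?case by auto
next
  case (Suc k)
  have mono: "mono_on {i..i + int k + 2} t"
    using Suc.prems by (simp add: algebra_simps)
  have IH1: "0 \<le> cox_de_boor I t k i x"
    "cox_de_boor I t k i x \<noteq> 0 \<longrightarrow> t i \<le> x \<and> x \<le> t (i + int k + 1)"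
    using Suc.IH[of i] mono_on_subset[OF mono, of "{i..i + int k + 1}"] by auto
  have IH2: "0 \<le> cox_de_boor I t k (i + 1) x"
    "cox_de_boor I t k (i + 1) x \<noteq> 0 \<longrightarrow> t (i + 1) \<le> x \<and> x \<le> t (i + int k + 2)"
    using Suc.IH[of "i + 1"] mono_on_subset[OF mono, of "{i + 1..i + int k + 2}"]
    by (auto simp: algebra_simps)
  have le: "t i \<le> t (i + 1)" "t i \<le> t (i + int k + 1)" "t (i + 1) \<le> t (i + int k + 2)"
    "t (i + int k + 1) \<le> t (i + int k + 2)"
    by (auto intro!: mono_onD[OF mono])
  let ?A = "(x - t i) / (t (i + int k + 1) - t i) * cox_de_boor I t k i x"
  let ?B = "(t (i + int k + 2) - x) / (t (i + int k + 2) - t (i + 1)) * cox_de_boor I t k (i + 1) x"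
  have A: "0 \<le> ?A"
    using IH1 le by (cases "cox_de_boor I t k i x = 0") (auto intro!: mult_nonneg_nonneg divide_nonneg_nonneg)
  have B: "0 \<le> ?B"
    using IH2 le by (cases "cox_de_boor I t k (i + 1) x = 0") (auto intro!: mult_nonneg_nonneg divide_nonneg_nonneg)
  have eq: "cox_de_boor I t (Suc k) i x = ?A + ?B" by simp
  have supp: "t i \<le> x \<and> x \<le> t (i + int k + 2)" if "?A + ?B \<noteq> 0"
  proof -
    have "cox_de_boor I t k i x \<noteq> 0 \<or> cox_de_boor I t k (i + 1) x \<noteq> 0"
      using that by auto
    then show ?thesis using IH1(2) IH2(2) le by force
  qed
  have last: "i + int (Suc k) + 1 = i + int k + 2" by simp
  show ?case unfolding eq last
    by (intro conjI[OF add_nonneg_nonneg[OF A B]] impI) (rule supp)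
qed

lemma bspline_nonneg:
  assumes "mono_on {j - int m..j + 1} t"
  shows "0 \<le> bspline m I t j x"
  unfolding bspline_def
  by (rule cox_de_boor_nonneg_support[THEN conjunct1]) (use assms in simp)

section \<open>Knots of a partition\<close>

lemma interval_knots_mono:
  assumes "interval_knots m n a b t"
  shows "mono_on {- int m..int n + int m} t"
proof (rule mono_onI)
  fix i j assume ij: "i \<in> {- int m..int n + int m}" "j \<in> {- int m..int n + int m}" "i \<le> j"
  have K: "\<And>i. i \<in> {- int m..0} \<Longrightarrow> t i = a" "\<And>i. i \<in> {int n..int n + int m} \<Longrightarrow> t i = b"
    "strict_mono_on {0..int n} t" using assms by (auto simp: interval_knots_def)
  \<comment> \<open>Outside \<open>{0..n}\<close> the knots repeat the end values, so indices may be clamped to it.\<close>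
  have clamp: "t (max 0 (min i (int n))) = t i" if "i \<in> {- int m..int n + int m}" for i
    using that K(1)[of i] K(1)[of 0] K(2)[of i] K(2)[of "int n"] by (auto simp: max_def min_def)
  show "t i \<le> t j"
    using ij mono_onD[OF strict_mono_on_imp_mono_on[OF K(3)],
        of "max 0 (min i (int n))" "max 0 (min j (int n))"] clamp[of i] clamp[of j] by auto
qed

lemma spline_partition_mono:
  assumes "spline_partition m I J t" "j \<in> J"
  shows "mono_on {j - int m..j + 1} t"
  using assms(1) unfolding spline_partition_def
proof (elim disjE exE conjE)
  assume "line_knots t"
  then show ?thesis by (simp add: line_knots_def mono_on_def strict_mono_less_eq)
next
  fix n a b assume "J = {0..int n + int m - 1}" "interval_knots m n a b t"
  then show ?thesis
    using assms(2) by (intro mono_on_subset[OF interval_knots_mono]) auto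
qed

lemma spline_partition_strict:
  assumes "spline_partition m I J t" "m \<ge> 1" "j - 1 \<in> J" "j + 1 \<in> J"
  shows "t (j - int m) < t j \<and> t (j - int m + 1) < t (j + 1)"
  using assms(1) unfolding spline_partition_def
proof (elim disjE exE conjE)
  assume "line_knots t"
  then show ?thesis using assms(2) by (simp add: line_knots_def strict_mono_less)
next
  fix n a b assume J: "J = {0..int n + int m - 1}" and K: "interval_knots m n a b t"
  \<comment> \<open>A window of \<open>m + 1\<close> knots off both ends contains two consecutive knots of \<open>t 0, \<dots>, t n\<close>.\<close>
  have less: "t i < t k" if "- int m \<le> i" "k \<le> int n + int m" "0 < k" "i < int n" "i < k" for i k
  proof -
    let ?l = "max 0 i"
    have "t i \<le> t ?l" "t (?l + 1) \<le> t k"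
      using that by (auto intro!: mono_onD[OF interval_knots_mono[OF K]])
    moreover have "t ?l < t (?l + 1)"
      using K that by (auto simp: interval_knots_def strict_mono_on_def)
    ultimately show ?thesis by linarith
  qed
  show ?thesis using assms J by (auto intro!: less)
qed

lemma spline_partition_theta_mem:
  assumes P: "spline_partition m I J t" and m: "m \<ge> 1" and j: "j \<in> J"
  shows "theta m t j \<in> I"
proof -
  have mem: "t (j - int r) \<in> I" if "r < m" for r
    using P unfolding spline_partition_def
  proof (elim disjE exE conjE)
    fix n a b assume IJ: "I = {a..b}" "J = {0..int n + int m - 1}" and K: "interval_knots m n a b t"
    have "t (- int m) = a" "t (int n + int m) = b"
      using K by (auto simp: interval_knots_def)
    moreover have "t (- int m) \<le> t (j - int r)" "t (j - int r) \<le> t (int n + int m)"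
      using IJ j that by (auto intro!: mono_onD[OF interval_knots_mono[OF K]])
    ultimately show ?thesis using IJ by simp
  qed simp
  have "convex I" using P unfolding spline_partition_def by auto
  then have "(\<Sum>r<m. (1 / real m) *\<^sub>R t (j - int r)) \<in> I"
    using m mem by (intro convex_sum) auto
  then show ?thesis by (simp add: theta_def sum_divide_distrib)
qed

section \<open>The norm of the quasi-interpolant\<close>

theorem theorem2:
  fixes m :: nat and I :: "real set" and J :: "int set" and t :: "int \<Rightarrow> real"
  assumes "m \<ge> 2"
    and "spline_partition m I J t"
  shows "operator_sup_norm I (Q2_star m I J t) \<le> ereal (of_int \<lfloor>(real m + 4) / 2\<rfloor>)"
proof -
  let ?C = "real (m div 2 + 2)"
  have C: "of_int \<lfloor>(real m + 4) / 2\<rfloor> = ?C"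
  proof -
    have "\<lfloor>(real m + 4) / 2\<rfloor> = \<lfloor>real (m + 4) / real 2\<rfloor>" by simp
    also have "\<dots> = int ((m + 4) div 2)" by (rule floor_divide_of_nat_eq)
    also have "(m + 4) div 2 = m div 2 + 2" by presburger
    finally show ?thesis by simp
  qed
  have "\<bar>Q2_star m I J t f x\<bar> \<le> ?C" if f: "sup_norm_on I f \<le> 1" and x: "x \<in> I" for f x
  proof -
    let ?B = "\<lambda>j. bspline m I t j x"
    have f1: "\<bar>f y\<bar> \<le> 1" if "y \<in> I" for y
    proof -
      have "ereal \<bar>f y\<bar> \<le> sup_norm_on I f"
        unfolding sup_norm_on_def using that by (rule SUP_upper)
      with f have "ereal \<bar>f y\<bar> \<le> 1" by (rule order_trans[rotated])
      then show ?thesis by simp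
    qed
    have mu: "\<bar>mu2 m J t j f\<bar> \<le> ?C" if "j \<in> J" for j
      using assms that
      by (intro mu2_abs_le spline_partition_mono spline_partition_strict f1
          spline_partition_theta_mem) auto
    have B0: "0 \<le> ?B j" if "j \<in> J" for j
      using assms(2) that by (intro bspline_nonneg spline_partition_mono)
    have B1: "infsum ?B J = 1" by (rule bspline_sum_eq_1[OF assms(2) x])
    \<comment> \<open>A sum that does not converge has the value 0 by convention, so the value 1 gives summability.\<close>
    have sB: "?B summable_on J"
      using B1 by (metis infsum_not_exists zero_neq_one)
    have sCB: "(\<lambda>j. ?C * ?B j) summable_on J"
      using sB by (rule summable_on_cmult_right)
    have le: "norm (mu2 m J t j f * ?B j) \<le> ?C * ?B j" if "j \<in> J" for j
      using mu[OF that] B0[OF that] by (simp add: abs_mult mult_right_mono)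
    have abs: "(\<lambda>j. norm (mu2 m J t j f * ?B j)) summable_on J"
      by (rule Infinite_Sum.abs_summable_on_comparison_test'[OF sCB le])
    have "\<bar>Q2_star m I J t f x\<bar> \<le> (\<Sum>\<^sub>\<infinity>j\<in>J. norm (mu2 m J t j f * ?B j))"
      unfolding Q2_star_def using norm_infsum_bound[OF abs] by simp
    also have "\<dots> \<le> (\<Sum>\<^sub>\<infinity>j\<in>J. ?C * ?B j)"
      by (rule infsum_mono[OF abs sCB le])
    also have "\<dots> = ?C * infsum ?B J" by (rule infsum_cmult_right) (use sB in simp)
    finally show ?thesis using B1 by simp
  qed
  then show ?thesis
    unfolding operator_sup_norm_def C
    by (auto intro!: SUP_least simp: sup_norm_on_def[of I "Q2_star m I J t _"])
qed

end
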